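(* Let $F$ be a field, and let $a_1<\cdots<a_d$ be positive integers with $\gcd(a_1,\dots,a_d)=1$ that non-redundantly generate their numerical semigroup. Let $A=F[[t^{a_1},\dots,t^{a_d}]]\subset F[[t]]$, let $R=F[[x_1,\dots,x_d]]$, and let $P$ be the defining ideal of $A$ in $R$, so that $A\cong R/P$. If the sequence $\{a_i\}$ has an arithmetic subsequence of length $5$, whose terms are not necessarily consecutive in $\{a_i\}$, then $P^2\neq P^{(2)}$.
   Context: The defining ideal $P$ of $A$ is the kernel of the $F$-algebra homomorphism $F[[x_1,\dots,x_d]]\to F[[t]]$ sending $x_i\mapsto t^{a_i}$ for all $i$; its image is $A$. Positive integers $a_1,\dots,a_d$ non-redundantly generate their numerical semigroup if no $a_i$ is a non-negative integer linear combination of the others. For a prime ideal $P$ of a Noetherian ring $R$ and a positive integer $n$, the $n$-th symbolic power is $P^{(n)}=P^nR_P\cap R=\{x\in R \mid \exists\, s\in R\setminus P,\ sx\in P^n\}$. *)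

theory Defs
  imports
    "HOL-Library.Poly_Mapping"
    "HOL-Computational_Algebra.Formal_Power_Series"
    "HOL-Algebra.Ideal_Product"
    "HOL-Algebra.QuotRing"
begin

section \<open>Formal power series in \<open>x\<^sub>1, \<dots>, x\<^sub>d\<close>\<close>

text \<open>
  A monomial \<open>x\<^sub>1^e\<^sub>1 \<cdots> x\<^sub>d^e\<^sub>d\<close> is represented by its exponent vector, a finitely supported
  function \<open>nat \<Rightarrow>\<^sub>0 nat\<close> with support in \<open>{1..d}\<close>; a power series is the family of its
  coefficients. Coefficients at exponent vectors involving further variables are required
  to vanish, so that equality of functions is equality of power series.
\<close>

definition exponents :: "nat \<Rightarrow> (nat \<Rightarrow>\<^sub>0 nat) set" where
  "exponents d = {m. Poly_Mapping.keys m \<subseteq> {1..d}}"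

definition antidiag :: "(nat \<Rightarrow>\<^sub>0 nat) \<Rightarrow> ((nat \<Rightarrow>\<^sub>0 nat) \<times> (nat \<Rightarrow>\<^sub>0 nat)) set" where
  "antidiag m = {(p, q). p + q = m}"

definition mps_ring :: "nat \<Rightarrow> ((nat \<Rightarrow>\<^sub>0 nat) \<Rightarrow> 'a::comm_ring_1) ring" where
  "mps_ring d =
     \<lparr> carrier = {f. \<forall>m. m \<notin> exponents d \<longrightarrow> f m = 0},
       mult = (\<lambda>f g m. \<Sum>(p, q)\<in>antidiag m. f p * g q),
       one = (\<lambda>m. if m = 0 then 1 else 0),
       zero = (\<lambda>m. 0),
       add = (\<lambda>f g m. f m + g m) \<rparr>"

definition mps_const :: "'a \<Rightarrow> (nat \<Rightarrow>\<^sub>0 nat) \<Rightarrow> 'a::comm_ring_1" where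
  "mps_const c = (\<lambda>m. if m = 0 then c else 0)"

definition mps_var :: "nat \<Rightarrow> (nat \<Rightarrow>\<^sub>0 nat) \<Rightarrow> 'a::comm_ring_1" where
  "mps_var i = (\<lambda>m. if m = Poly_Mapping.single i 1 then 1 else 0)"

definition fps_ring :: "'a::comm_ring_1 fps ring" where
  "fps_ring = \<lparr> carrier = UNIV, mult = (*), one = 1, zero = 0, add = (+) \<rparr>"


section \<open>The defining ideal\<close>

definition weight :: "nat \<Rightarrow> (nat \<Rightarrow> nat) \<Rightarrow> (nat \<Rightarrow>\<^sub>0 nat) \<Rightarrow> nat" where
  "weight d a m = (\<Sum>i\<in>{1..d}. Poly_Mapping.lookup m i * a i)"

definition exponents_of_weight :: "nat \<Rightarrow> (nat \<Rightarrow> nat) \<Rightarrow> nat \<Rightarrow> (nat \<Rightarrow>\<^sub>0 nat) set" where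
  "exponents_of_weight d a n = {m \<in> exponents d. weight d a m = n}"

text \<open>
  The substitution \<open>x\<^sub>i \<mapsto> t^(a i)\<close>: the monomial with exponent vector \<open>m\<close> goes to
  \<open>t^(weight d a m)\<close>. The sums are finite provided that \<open>a i > 0\<close> for all \<open>i\<close>.
\<close>

definition subst_hom :: "nat \<Rightarrow> (nat \<Rightarrow> nat) \<Rightarrow> ((nat \<Rightarrow>\<^sub>0 nat) \<Rightarrow> 'a::comm_ring_1) \<Rightarrow> 'a fps" where
  "subst_hom d a f = Abs_fps (\<lambda>n. \<Sum>m\<in>exponents_of_weight d a n. f m)"

definition defining_ideal :: "nat \<Rightarrow> (nat \<Rightarrow> nat) \<Rightarrow> ((nat \<Rightarrow>\<^sub>0 nat) \<Rightarrow> 'a::comm_ring_1) set" where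
  "defining_ideal d a = a_kernel (mps_ring d) fps_ring (subst_hom d a)"

text \<open>The subring \<open>F[[t^(a 1), \<dots>, t^(a d)]]\<close> of \<open>F[[t]]\<close>.\<close>

definition numerical_semigroup :: "nat \<Rightarrow> (nat \<Rightarrow> nat) \<Rightarrow> nat set" where
  "numerical_semigroup d a = {n. \<exists>c :: nat \<Rightarrow> nat. n = (\<Sum>i\<in>{1..d}. c i * a i)}"

definition semigroup_fps :: "nat \<Rightarrow> (nat \<Rightarrow> nat) \<Rightarrow> 'a::comm_ring_1 fps set" where
  "semigroup_fps d a = {f. \<forall>n. n \<notin> numerical_semigroup d a \<longrightarrow> fps_nth f n = 0}"

definition nonredundant :: "nat \<Rightarrow> (nat \<Rightarrow> nat) \<Rightarrow> bool" where
  "nonredundant d a \<longleftrightarrow>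
     (\<forall>i\<in>{1..d}. \<not> (\<exists>c :: nat \<Rightarrow> nat. a i = (\<Sum>j\<in>{1..d} - {i}. c j * a j)))"


section \<open>Symbolic powers\<close>

text \<open>
  \<open>P [^]\<^bsub>ideals_set R\<^esub> n\<close> is the \<open>n\<close>-th power of the ideal \<open>P\<close>, formed in the monoid of
  ideals of \<open>R\<close> under the product of ideals.
\<close>

definition symbolic_power ::
    "('b, 'c) ring_scheme \<Rightarrow> 'b set \<Rightarrow> nat \<Rightarrow> 'b set" where
  "symbolic_power R P n =
     {x \<in> carrier R. \<exists>s \<in> carrier R - P. s \<otimes>\<^bsub>R\<^esub> x \<in> P [^]\<^bsub>ideals_set R\<^esub> n}"


section \<open>Arithmetic subsequences\<close>

text \<open>
  The terms \<open>a (k 0), \<dots>, a (k (l - 1))\<close> with strictly increasing indices in \<open>{1..d}\<close>, which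
  need not be consecutive, form an arithmetic progression.
\<close>

definition has_arith_subseq :: "nat \<Rightarrow> (nat \<Rightarrow> nat) \<Rightarrow> nat \<Rightarrow> bool" where
  "has_arith_subseq d a l \<longleftrightarrow>
     (\<exists>k :: nat \<Rightarrow> nat. \<exists>\<delta> :: nat. strict_mono_on {..<l} k \<and> k ` {..<l} \<subseteq> {1..d} \<and>
        (\<forall>j. Suc j < l \<longrightarrow> a (k (Suc j)) = a (k j) + \<delta>))"


section \<open>The power series ring is a commutative ring\<close>

lemma finite_antidiag: "finite (antidiag m)"
proof -
  let ?A = "{p. \<exists>q. p + q = m}"
  let ?F = "{f :: nat \<Rightarrow> nat. (\<forall>x. (x \<in> Poly_Mapping.keys m \<longrightarrow> f x \<in> {..Max (Poly_Mapping.lookup m ` Poly_Mapping.keys m)}) \<and>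
              (x \<notin> Poly_Mapping.keys m \<longrightarrow> f x = 0))}"
  have "finite ?F"
    by (rule finite_set_of_finite_funs) auto
  moreover have "Poly_Mapping.lookup ` ?A \<subseteq> ?F"
  proof
    fix f assume "f \<in> Poly_Mapping.lookup ` ?A"
    then obtain p q where f: "f = Poly_Mapping.lookup p" and pq: "p + q = m" by auto
    have le: "f x \<le> Poly_Mapping.lookup m x" for x
      using f pq by (auto simp: lookup_add)
    have "f x = 0" if "x \<notin> Poly_Mapping.keys m" for x
      using le[of x] that by (simp add: in_keys_iff)
    moreover have "f x \<le> Max (Poly_Mapping.lookup m ` Poly_Mapping.keys m)"
      if "x \<in> Poly_Mapping.keys m" for x
      using le[of x] that by (meson Max_ge finite_imageI finite_keys imageI le_trans)
    ultimately show "f \<in> ?F" by auto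
  qed
  ultimately have "finite (Poly_Mapping.lookup ` ?A)" by (rule rev_finite_subset)
  then have "finite ?A"
    by (rule finite_imageD) (simp add: inj_on_def poly_mapping_eqI)
  moreover have "antidiag m \<subseteq> ?A \<times> ?A"
    unfolding antidiag_def using add.commute by blast
  ultimately show ?thesis by (meson finite_SigmaI finite_subset)
qed

lemma exponents_add_iff: "p + q \<in> exponents d \<longleftrightarrow> p \<in> exponents d \<and> q \<in> exponents d"
proof -
  have "Poly_Mapping.keys (p + q) = Poly_Mapping.keys p \<union> Poly_Mapping.keys q"
    for p q :: "nat \<Rightarrow>\<^sub>0 nat"
    by (auto simp: in_keys_iff lookup_add)
  then show ?thesis by (auto simp: exponents_def)
qed

lemma zero_in_exponents [simp]: "0 \<in> exponents d"
  by (simp add: exponents_def)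

lemma mps_mult_commute:
  fixes f g :: "(nat \<Rightarrow>\<^sub>0 nat) \<Rightarrow> 'a::comm_ring_1"
  shows "(\<Sum>(p, q)\<in>antidiag m. f p * g q) = (\<Sum>(p, q)\<in>antidiag m. g p * f q)"
  by (rule sum.reindex_bij_witness[where i = prod.swap and j = prod.swap])
     (auto simp: antidiag_def add.commute mult.commute)

lemma mps_mult_assoc:
  fixes f g h :: "(nat \<Rightarrow>\<^sub>0 nat) \<Rightarrow> 'a::comm_ring_1"
  shows "(\<Sum>(p, q)\<in>antidiag m. (\<Sum>(r, s)\<in>antidiag p. f r * g s) * h q) =
         (\<Sum>(p, q)\<in>antidiag m. f p * (\<Sum>(r, s)\<in>antidiag q. g r * h s))"
proof -
  have "(\<Sum>(p, q)\<in>antidiag m. (\<Sum>(r, s)\<in>antidiag p. f r * g s) * h q) =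
        (\<Sum>x\<in>antidiag m. \<Sum>y\<in>antidiag (fst x). f (fst y) * g (snd y) * h (snd x))"
    by (simp add: sum_distrib_right case_prod_unfold)
  also have "\<dots> = (\<Sum>(x, y)\<in>(SIGMA x:antidiag m. antidiag (fst x)). f (fst y) * g (snd y) * h (snd x))"
    by (rule sum.Sigma) (auto simp: finite_antidiag)
  also have "\<dots> = (\<Sum>(x, y)\<in>(SIGMA x:antidiag m. antidiag (snd x)). f (fst x) * (g (fst y) * h (snd y)))"
    by (rule sum.reindex_bij_witness[where
          i = "\<lambda>((p, q), (r, s)). ((p + r, s), (p, r))" and
          j = "\<lambda>((p, q), (r, s)). ((r, s + q), (s, q))"])
       (auto simp: antidiag_def add.assoc mult.assoc)
  also have "\<dots> = (\<Sum>x\<in>antidiag m. \<Sum>y\<in>antidiag (snd x). f (fst x) * (g (fst y) * h (snd y)))"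
    by (rule sum.Sigma[symmetric]) (auto simp: finite_antidiag)
  also have "\<dots> = (\<Sum>(p, q)\<in>antidiag m. f p * (\<Sum>(r, s)\<in>antidiag q. g r * h s))"
    by (simp add: sum_distrib_left case_prod_unfold)
  finally show ?thesis .
qed

lemma mps_mult_one:
  fixes f :: "(nat \<Rightarrow>\<^sub>0 nat) \<Rightarrow> 'a::comm_ring_1"
  shows "(\<Sum>(p, q)\<in>antidiag m. (if p = 0 then c else 0) * f q) = c * f m"
proof -
  have "(\<Sum>(p, q)\<in>antidiag m. (if p = 0 then c else 0) * f q) =
        (\<Sum>(p, q)\<in>{(0 :: nat \<Rightarrow>\<^sub>0 nat, m)}. (if p = 0 then c else 0) * f q)"
    by (rule sum.mono_neutral_right)
       (use finite_antidiag[of m] in \<open>auto simp: antidiag_def split: if_splits\<close>)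
  then show ?thesis by simp
qed

lemma cring_mps_ring: "cring (mps_ring d :: ((nat \<Rightarrow>\<^sub>0 nat) \<Rightarrow> 'a::comm_ring_1) ring)"
proof (rule cringI)
  let ?R = "mps_ring d :: ((nat \<Rightarrow>\<^sub>0 nat) \<Rightarrow> 'a) ring"
  show "abelian_group ?R"
  proof (rule abelian_groupI)
    fix x assume x: "x \<in> carrier ?R"
    then have "(\<lambda>m. - x m) \<in> carrier ?R" by (auto simp: mps_ring_def)
    moreover have "(\<lambda>m. - x m) \<oplus>\<^bsub>?R\<^esub> x = \<zero>\<^bsub>?R\<^esub>" by (simp add: mps_ring_def)
    ultimately show "\<exists>y\<in>carrier ?R. y \<oplus>\<^bsub>?R\<^esub> x = \<zero>\<^bsub>?R\<^esub>" by blast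
  qed (auto simp: mps_ring_def algebra_simps)
  show "comm_monoid ?R"
  proof (rule comm_monoidI)
    fix x y assume xy: "x \<in> carrier ?R" "y \<in> carrier ?R"
    show "x \<otimes>\<^bsub>?R\<^esub> y \<in> carrier ?R"
      using xy by (auto simp: mps_ring_def antidiag_def exponents_add_iff intro!: sum.neutral)
    show "x \<otimes>\<^bsub>?R\<^esub> y = y \<otimes>\<^bsub>?R\<^esub> x"
      by (simp add: mps_ring_def mps_mult_commute[of x y])
  qed (auto simp: mps_ring_def mps_mult_assoc mps_mult_one)
  show "(x \<oplus>\<^bsub>?R\<^esub> y) \<otimes>\<^bsub>?R\<^esub> z = x \<otimes>\<^bsub>?R\<^esub> z \<oplus>\<^bsub>?R\<^esub> y \<otimes>\<^bsub>?R\<^esub> z"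
    if "x \<in> carrier ?R" "y \<in> carrier ?R" "z \<in> carrier ?R" for x y z
    by (auto simp: mps_ring_def case_prod_unfold distrib_right sum.distrib)
qed

lemma cring_fps_ring: "cring (fps_ring :: 'a::comm_ring_1 fps ring)"
proof (rule cringI)
  let ?S = "fps_ring :: 'a fps ring"
  show "abelian_group ?S"
  proof (rule abelian_groupI)
    fix x assume "x \<in> carrier ?S"
    show "\<exists>y\<in>carrier ?S. y \<oplus>\<^bsub>?S\<^esub> x = \<zero>\<^bsub>?S\<^esub>"
      by (rule bexI[of _ "- x"]) (auto simp: fps_ring_def)
  qed (auto simp: fps_ring_def algebra_simps)
  show "comm_monoid ?S"
    by (rule comm_monoidI) (auto simp: fps_ring_def algebra_simps)
qed (auto simp: fps_ring_def algebra_simps)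


section \<open>The substitution is a homomorphism of algebras with image \<open>A\<close>\<close>

lemma weight_add: "weight d a (p + q) = weight d a p + weight d a q"
  by (simp add: weight_def lookup_add algebra_simps sum.distrib)

lemma finite_exponents_of_weight:
  assumes "\<forall>i\<in>{1..d}. a i > 0"
  shows "finite (exponents_of_weight d a n)"
proof -
  let ?F = "{f :: nat \<Rightarrow> nat. (\<forall>x. (x \<in> {1..d} \<longrightarrow> f x \<in> {..n}) \<and> (x \<notin> {1..d} \<longrightarrow> f x = 0))}"
  have "finite ?F" by (rule finite_set_of_finite_funs) auto
  moreover have "Poly_Mapping.lookup ` exponents_of_weight d a n \<subseteq> ?F"
  proof
    fix f assume "f \<in> Poly_Mapping.lookup ` exponents_of_weight d a n"
    then obtain m where f: "f = Poly_Mapping.lookup m" and k: "Poly_Mapping.keys m \<subseteq> {1..d}"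
      and w: "weight d a m = n"
      by (auto simp: exponents_of_weight_def exponents_def)
    have "f x \<le> n" if "x \<in> {1..d}" for x
    proof -
      have "f x \<le> f x * a x" using assms that by (simp add: Suc_le_eq)
      also have "\<dots> \<le> (\<Sum>i\<in>{1..d}. f i * a i)"
        by (rule member_le_sum[OF that]) auto
      finally show ?thesis using w f by (simp add: weight_def)
    qed
    moreover have "f x = 0" if "x \<notin> {1..d}" for x
      using k that f by (metis in_keys_iff subsetD)
    ultimately show "f \<in> ?F" by auto
  qed
  ultimately have "finite (Poly_Mapping.lookup ` exponents_of_weight d a n)"
    by (rule rev_finite_subset)
  then show ?thesis
    by (rule finite_imageD) (simp add: inj_on_def poly_mapping_eqI)
qed

lemma subst_hom_mult:
  fixes f g :: "(nat \<Rightarrow>\<^sub>0 nat) \<Rightarrow> 'a::comm_ring_1"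
  assumes a: "\<forall>i\<in>{1..d}. a i > 0"
  shows "subst_hom d a (f \<otimes>\<^bsub>mps_ring d\<^esub> g) = subst_hom d a f * subst_hom d a g"
proof (rule fps_ext)
  fix n
  let ?W = "exponents_of_weight d a"
  have fin: "finite (?W k)" for k using a by (rule finite_exponents_of_weight)
  have "fps_nth (subst_hom d a (f \<otimes>\<^bsub>mps_ring d\<^esub> g)) n =
          (\<Sum>m\<in>?W n. \<Sum>x\<in>antidiag m. f (fst x) * g (snd x))"
    by (simp add: subst_hom_def mps_ring_def case_prod_unfold)
  also have "\<dots> = (\<Sum>(m, x)\<in>(SIGMA m:?W n. antidiag m). f (fst x) * g (snd x))"
    by (rule sum.Sigma) (auto simp: fin finite_antidiag)
  also have "\<dots> = (\<Sum>(i, x)\<in>(SIGMA i:{0..n}. ?W i \<times> ?W (n - i)). f (fst x) * g (snd x))"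
    by (rule sum.reindex_bij_witness[where
          i = "\<lambda>(i, x). (fst x + snd x, x)" and j = "\<lambda>(m, x). (weight d a (fst x), x)"])
       (auto simp: antidiag_def exponents_of_weight_def exponents_add_iff weight_add)
  also have "\<dots> = (\<Sum>i=0..n. \<Sum>x\<in>?W i \<times> ?W (n - i). f (fst x) * g (snd x))"
    by (rule sum.Sigma[symmetric]) (auto simp: fin)
  also have "\<dots> = (\<Sum>i=0..n. (\<Sum>p\<in>?W i. f p) * (\<Sum>q\<in>?W (n - i). g q))"
    by (simp add: sum_product sum.cartesian_product case_prod_unfold)
  also have "\<dots> = fps_nth (subst_hom d a f * subst_hom d a g) n"
    by (simp add: subst_hom_def fps_mult_nth)
  finally show "fps_nth (subst_hom d a (f \<otimes>\<^bsub>mps_ring d\<^esub> g)) n =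
                fps_nth (subst_hom d a f * subst_hom d a g) n" .
qed

lemma subst_hom_delta:
  fixes c :: "'a::comm_ring_1"
  assumes a: "\<forall>i\<in>{1..d}. a i > 0" and m0: "m0 \<in> exponents d"
  shows "subst_hom d a (\<lambda>m. if m = m0 then c else 0) = fps_const c * fps_X ^ weight d a m0"
proof (rule fps_ext)
  fix n
  have "(\<Sum>m\<in>exponents_of_weight d a n. if m = m0 then c else 0) =
        (if m0 \<in> exponents_of_weight d a n then c else 0)"
    using finite_exponents_of_weight[OF a] by (simp add: sum.delta')
  then show "fps_nth (subst_hom d a (\<lambda>m. if m = m0 then c else 0)) n =
             fps_nth (fps_const c * fps_X ^ weight d a m0) n"
    using m0 by (auto simp: subst_hom_def exponents_of_weight_def fps_X_power_nth)
qed

lemma subst_hom_const: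
  assumes "\<forall>i\<in>{1..d}. a i > 0"
  shows "subst_hom d a (mps_const c) = fps_const c"
  using subst_hom_delta[OF assms, of 0 c] by (simp add: mps_const_def weight_def)

lemma subst_hom_var:
  assumes "\<forall>i\<in>{1..d}. a i > 0" "i \<in> {1..d}"
  shows "subst_hom d a (mps_var i) = fps_X ^ a i"
proof -
  have "Poly_Mapping.single i (1::nat) \<in> exponents d"
    using assms(2) by (auto simp: exponents_def)
  moreover have "weight d a (Poly_Mapping.single i 1) = a i"
  proof -
    have "weight d a (Poly_Mapping.single i 1) = (\<Sum>j\<in>{1..d}. if j = i then a j else 0)"
      unfolding weight_def by (rule sum.cong) (auto simp: lookup_single when_def)
    then show ?thesis using assms(2) by (simp add: sum.delta')
  qed
  ultimately show ?thesis
    using subst_hom_delta[OF assms(1), of "Poly_Mapping.single i 1" 1] by (simp add: mps_var_def)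
qed

lemma ring_hom_subst_hom:
  assumes "\<forall>i\<in>{1..d}. a i > 0"
  shows "ring_hom_ring (mps_ring d) (fps_ring :: 'a::comm_ring_1 fps ring) (subst_hom d a)"
proof (rule ring_hom_ringI)
  show "ring (mps_ring d :: ((nat \<Rightarrow>\<^sub>0 nat) \<Rightarrow> 'a) ring)"
    using cring_mps_ring by (rule cring.axioms)
  show "ring (fps_ring :: 'a fps ring)"
    using cring_fps_ring by (rule cring.axioms)
  show "subst_hom d a \<one>\<^bsub>mps_ring d\<^esub> = \<one>\<^bsub>fps_ring :: 'a fps ring\<^esub>"
    using subst_hom_const[OF assms, of 1] by (simp add: mps_const_def mps_ring_def fps_ring_def)
  show "subst_hom d a (f \<otimes>\<^bsub>mps_ring d\<^esub> g) = subst_hom d a f \<otimes>\<^bsub>fps_ring\<^esub> subst_hom d a g"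
    for f g :: "(nat \<Rightarrow>\<^sub>0 nat) \<Rightarrow> 'a"
    using subst_hom_mult[OF assms, of f g] by (simp add: fps_ring_def)
qed (auto simp: fps_ring_def mps_ring_def subst_hom_def sum.distrib fps_eq_iff)

lemma subst_hom_image:
  assumes a: "\<forall>i\<in>{1..d}. a i > 0"
  shows "subst_hom d a ` carrier (mps_ring d) = (semigroup_fps d a :: 'a::comm_ring_1 fps set)"
proof (intro equalityI subsetI)
  fix g :: "'a fps" assume "g \<in> subst_hom d a ` carrier (mps_ring d)"
  then obtain f where g: "g = subst_hom d a f" by blast
  have "exponents_of_weight d a n = {}" if "n \<notin> numerical_semigroup d a" for n
    using that by (auto simp: exponents_of_weight_def numerical_semigroup_def weight_def)
  then show "g \<in> semigroup_fps d a"
    by (auto simp: g semigroup_fps_def subst_hom_def)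
next
  fix g :: "'a fps" assume g: "g \<in> semigroup_fps d a"
  have ex: "\<exists>m. m \<in> exponents_of_weight d a n" if n: "n \<in> numerical_semigroup d a" for n
  proof -
    obtain c :: "nat \<Rightarrow> nat" where c: "n = (\<Sum>i\<in>{1..d}. c i * a i)"
      using n by (auto simp: numerical_semigroup_def)
    define m where "m = Poly_Mapping.Abs_poly_mapping (\<lambda>i. if i \<in> {1..d} then c i else 0)"
    have "finite {i. (if i \<in> {1..d} then c i else 0) \<noteq> 0}"
      by (rule finite_subset[of _ "{1..d}"]) auto
    then have l: "Poly_Mapping.lookup m = (\<lambda>i. if i \<in> {1..d} then c i else 0)"
      by (simp add: m_def Abs_poly_mapping_inverse)
    have "Poly_Mapping.keys m \<subseteq> {1..d}"
      by (auto simp: in_keys_iff l split: if_splits)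
    moreover have "weight d a m = n"
      by (simp add: weight_def l c)
    ultimately show ?thesis by (auto simp: exponents_of_weight_def exponents_def)
  qed
  define e where "e n = (SOME m. m \<in> exponents_of_weight d a n)" for n
  have e: "e n \<in> exponents_of_weight d a n" if "n \<in> numerical_semigroup d a" for n
    unfolding e_def using ex[OF that] by (rule someI_ex)
  define f where "f m = (if m \<in> exponents d \<and> m = e (weight d a m) then fps_nth g (weight d a m) else 0)" for m
  have "f \<in> carrier (mps_ring d)" by (simp add: mps_ring_def f_def)
  moreover have "subst_hom d a f = g"
  proof (rule fps_ext)
    fix n
    have "fps_nth (subst_hom d a f) n = (\<Sum>m\<in>exponents_of_weight d a n. if m = e n then fps_nth g n else 0)"
      by (auto simp: subst_hom_def f_def exponents_of_weight_def intro!: sum.cong)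
    also have "\<dots> = (if e n \<in> exponents_of_weight d a n then fps_nth g n else 0)"
      using finite_exponents_of_weight[OF a] by (simp add: sum.delta')
    also have "\<dots> = fps_nth g n"
      using e[of n] g by (auto simp: semigroup_fps_def)
    finally show "fps_nth (subst_hom d a f) n = fps_nth g n" .
  qed
  ultimately show "g \<in> subst_hom d a ` carrier (mps_ring d)" by blast
qed

lemma quotient_defining_ideal_iso:
  assumes "\<forall>i\<in>{1..d}. a i > 0"
  shows "(mps_ring d :: ((nat \<Rightarrow>\<^sub>0 nat) \<Rightarrow> 'a::comm_ring_1) ring) Quot defining_ideal d a \<simeq>
         (fps_ring :: 'a fps ring)\<lparr>carrier := semigroup_fps d a\<rparr>"
proof -
  note hom = ring_hom_subst_hom[OF assms, where ?'a = 'a]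
  show ?thesis
    unfolding is_ring_iso_def defining_ideal_def subst_hom_image[OF assms, symmetric]
    by (rule ex_in_conv[THEN iffD1], rule exI, rule ring_hom_ring.FactRing_iso_set_aux[OF hom])
qed

lemma defining_ideal_iff:
  "f \<in> defining_ideal d a \<longleftrightarrow> f \<in> carrier (mps_ring d) \<and> subst_hom d a f = 0"
  by (simp add: defining_ideal_def a_kernel_def' fps_ring_def)

lemma primeideal_defining_ideal:
  assumes a: "\<forall>i\<in>{1..d}. a i > 0"
  shows "primeideal (defining_ideal d a) (mps_ring d :: ((nat \<Rightarrow>\<^sub>0 nat) \<Rightarrow> 'a::field) ring)"
proof (rule primeidealI)
  let ?P = "defining_ideal d a :: ((nat \<Rightarrow>\<^sub>0 nat) \<Rightarrow> 'a) set"
  note hom = ring_hom_subst_hom[OF a, where ?'a = 'a]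
  show "ideal ?P (mps_ring d)"
    unfolding defining_ideal_def using hom by (rule ring_hom_ring.kernel_is_ideal)
  show "carrier (mps_ring d) \<noteq> ?P"
  proof -
    have "mps_const 1 \<in> carrier (mps_ring d)"
      by (simp add: mps_ring_def mps_const_def)
    moreover have "mps_const 1 \<notin> ?P"
      by (simp add: defining_ideal_iff subst_hom_const[OF a])
    ultimately show ?thesis by blast
  qed
  show "x \<in> ?P \<or> y \<in> ?P"
    if "x \<in> carrier (mps_ring d)" "y \<in> carrier (mps_ring d)" "x \<otimes>\<^bsub>mps_ring d\<^esub> y \<in> ?P" for x y
  proof -
    have "subst_hom d a x * subst_hom d a y = 0"
      using that(3) unfolding defining_ideal_iff subst_hom_mult[OF a] by (rule conjunct2)
    then have "subst_hom d a x = 0 \<or> subst_hom d a y = 0"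
      by simp
    then show ?thesis
      using that(1,2) unfolding defining_ideal_iff by blast
  qed
qed (rule cring_mps_ring)

end

theory Submission
  imports Defs
begin

text \<open>
  Let \<open>x\<^sub>0, \<dots>, x\<^sub>4\<close> be the variables of the arithmetic subsequence and \<open>D\<close> the determinant of the
  Hankel matrix with rows \<open>x\<^sub>0 x\<^sub>1 x\<^sub>2\<close>, \<open>x\<^sub>1 x\<^sub>2 x\<^sub>3\<close> and \<open>x\<^sub>2 x\<^sub>3 x\<^sub>4\<close>. Its \<open>2 \<times> 2\<close> minors lie
  in \<open>P\<close>, so Dodgson condensation gives \<open>x\<^sub>2 D \<in> P\<^sup>2\<close>, hence \<open>D \<in> P\<^sup>(\<^sup>2\<^sup>)\<close>. Non-redundancy means that
  no element of \<open>P\<close> has a linear term; thus all elements of \<open>P\<^sup>2\<close> have order at least 4, whereas \<open>D\<close>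
  is a nonzero cubic form.
\<close>

section \<open>Identities in a commutative ring\<close>

text \<open>Desnanot-Jacobi identity: the central entry times the determinant is the product of the
  two diagonal corner minors minus the product of the two off-diagonal ones. The matrix is
  symmetric, so the latter two coincide.\<close>

lemma (in cring) hankel_condensation:
  assumes "x0 \<in> carrier R" "x1 \<in> carrier R" "x2 \<in> carrier R" "x3 \<in> carrier R" "x4 \<in> carrier R"
  shows "x2 \<otimes> (x0 \<otimes> x2 \<otimes> x4 \<oplus> x1 \<otimes> x2 \<otimes> x3 \<oplus> x1 \<otimes> x2 \<otimes> x3
           \<ominus> x2 \<otimes> x2 \<otimes> x2 \<ominus> x0 \<otimes> x3 \<otimes> x3 \<ominus> x1 \<otimes> x1 \<otimes> x4)
       = (x0 \<otimes> x2 \<ominus> x1 \<otimes> x1) \<otimes> (x2 \<otimes> x4 \<ominus> x3 \<otimes> x3)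
           \<ominus> (x1 \<otimes> x3 \<ominus> x2 \<otimes> x2) \<otimes> (x1 \<otimes> x3 \<ominus> x2 \<otimes> x2)"
  using assms by algebra

lemma (in cring) ideals_set_power2:
  assumes "ideal I R"
  shows "I [^]\<^bsub>ideals_set R\<^esub> (2::nat) = I \<cdot> I"
proof -
  interpret M: comm_monoid "ideals_set R" by (rule ideals_set_is_comm_monoid)
  have "I \<in> carrier (ideals_set R)"
    using assms by (simp add: ideals_set_def)
  then have "I [^]\<^bsub>ideals_set R\<^esub> (2::nat) = I \<otimes>\<^bsub>ideals_set R\<^esub> I"
    by (simp add: numeral_2_eq_2)
  then show ?thesis by (simp add: ideals_set_def)
qed

section \<open>Degrees, monomials and coefficients\<close>

text \<open>Total degree is the weight in which every variable counts 1, so the lemmas on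
  \<open>weight\<close> serve for both gradings.\<close>

abbreviation monomial_degree :: "nat \<Rightarrow> (nat \<Rightarrow>\<^sub>0 nat) \<Rightarrow> nat" where
  "monomial_degree d \<equiv> weight d (\<lambda>_. 1)"

definition mps_monom :: "(nat \<Rightarrow>\<^sub>0 nat) \<Rightarrow> (nat \<Rightarrow>\<^sub>0 nat) \<Rightarrow> 'a::comm_ring_1" where
  "mps_monom p = (\<lambda>m. if m = p then 1 else 0)"

lemma mps_var_eq_monom: "mps_var i = mps_monom (Poly_Mapping.single i 1)"
  by (simp add: mps_var_def mps_monom_def)

lemma mps_monom_mult:
  "mps_monom p \<otimes>\<^bsub>mps_ring d\<^esub> mps_monom q = (mps_monom (p + q) :: _ \<Rightarrow> 'a::comm_ring_1)"
proof
  fix m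
  have "(\<Sum>(r, s)\<in>antidiag m. mps_monom p r * mps_monom q s) =
        (\<Sum>x\<in>antidiag m. if x = (p, q) then 1 else 0 :: 'a)"
    by (rule sum.cong) (auto simp: mps_monom_def split: if_splits)
  also have "\<dots> = mps_monom (p + q) m"
    by (simp add: sum.delta finite_antidiag) (auto simp: antidiag_def mps_monom_def)
  finally show "(mps_monom p \<otimes>\<^bsub>mps_ring d\<^esub> mps_monom q) m = (mps_monom (p + q) m :: 'a)"
    by (simp add: mps_ring_def)
qed

lemma mps_var_closed: "i \<in> {1..d} \<Longrightarrow> mps_var i \<in> carrier (mps_ring d)"
  by (auto simp: mps_ring_def mps_var_def exponents_def)

lemma mps_minus_apply:
  fixes f g :: "(nat \<Rightarrow>\<^sub>0 nat) \<Rightarrow> 'a::comm_ring_1"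
  assumes "f \<in> carrier (mps_ring d)" "g \<in> carrier (mps_ring d)"
  shows "(f \<ominus>\<^bsub>mps_ring d\<^esub> g) m = f m - g m"
proof -
  interpret cring "mps_ring d :: ((nat \<Rightarrow>\<^sub>0 nat) \<Rightarrow> 'a) ring" by (rule cring_mps_ring)
  \<comment> \<open>The additive inverse of the ring is known only through its defining property, so
    the coefficients of the difference are found by adding \<open>g\<close> back.\<close>
  have "(f \<ominus>\<^bsub>mps_ring d\<^esub> g) \<oplus>\<^bsub>mps_ring d\<^esub> g = f"
    using assms by algebra
  then have "(f \<ominus>\<^bsub>mps_ring d\<^esub> g) m + g m = f m"
    by (simp add: mps_ring_def fun_eq_iff)
  then show ?thesis by (simp add: eq_diff_eq)
qed

lemma mps_add_apply: "(f \<oplus>\<^bsub>mps_ring d\<^esub> g) m = f m + g m"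
  by (simp add: mps_ring_def)

section \<open>Weights and the order of elements of P\<close>

lemma weight_single:
  assumes "i \<in> {1..d}"
  shows "weight d a (Poly_Mapping.single i n) = n * a i"
proof -
  have "weight d a (Poly_Mapping.single i n) = (\<Sum>j\<in>{1..d}. if j = i then n * a j else 0)"
    unfolding weight_def by (rule sum.cong) (auto simp: lookup_single when_def)
  then show ?thesis using assms by (simp add: sum.delta')
qed

text \<open>\<open>weight\<close> does not see variables outside \<open>{1..d}\<close>; membership
  in \<open>exponents d\<close> rules them out.\<close>

lemma weight_eq_0_iff:
  assumes "\<forall>i\<in>{1..d}. a i > 0" "m \<in> exponents d"
  shows "weight d a m = 0 \<longleftrightarrow> m = 0"
proof
  assume "weight d a m = 0"
  then have "\<forall>i\<in>{1..d}. Poly_Mapping.lookup m i * a i = 0"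
    by (simp add: weight_def)
  then have "\<forall>i\<in>{1..d}. Poly_Mapping.lookup m i = 0"
    using assms(1) by (metis less_numeral_extra(3) mult_is_0)
  then have "Poly_Mapping.keys m = {}"
    using assms(2) unfolding exponents_def by (metis in_keys_iff mem_Collect_eq subsetD subsetI subset_empty)
  then show "m = 0" by simp
qed (simp add: weight_def)

lemma single_add_diff:
  assumes "0 < Poly_Mapping.lookup m i"
  shows "\<exists>r. m = Poly_Mapping.single i (1::nat) + r"
proof
  show "m = Poly_Mapping.single i 1 + (m - Poly_Mapping.single i 1)"
    by (rule poly_mapping_eqI) (use assms in \<open>auto simp: lookup_add lookup_minus lookup_single when_def\<close>)
qed

text \<open>A monomial of weight \<open>a i\<close> without the i-th variable would write
  \<open>a i\<close> as a combination of the other generators. Once that variable is split off, the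
  cofactor has weight 0 and is 1.\<close>

lemma nonredundant_exponents_of_weight:
  assumes pos: "\<forall>i\<in>{1..d}. a i > 0" and nr: "nonredundant d a" and i: "i \<in> {1..d}"
  shows "exponents_of_weight d a (a i) = {Poly_Mapping.single i 1}"
proof (intro equalityI subsetI)
  fix m assume "m \<in> exponents_of_weight d a (a i)"
  then have m: "m \<in> exponents d" and w: "weight d a m = a i"
    by (auto simp: exponents_of_weight_def)
  have "Poly_Mapping.lookup m i \<noteq> 0"
  proof
    assume "Poly_Mapping.lookup m i = 0"
    then have "a i = (\<Sum>j\<in>{1..d} - {i}. Poly_Mapping.lookup m j * a j)"
      using w sum.remove[OF _ i, of "\<lambda>j. Poly_Mapping.lookup m j * a j"] by (simp add: weight_def)
    then show False using nr i unfolding nonredundant_def by blast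
  qed
  then obtain r where r: "m = Poly_Mapping.single i 1 + r"
    using single_add_diff[of m i] by auto
  then have "weight d a r = 0"
    using w weight_single[OF i, of a 1] by (simp add: weight_add)
  then show "m \<in> {Poly_Mapping.single i 1}"
    using weight_eq_0_iff[OF pos] m r by (simp add: exponents_add_iff)
next
  fix m assume "m \<in> {Poly_Mapping.single i (1::nat)}"
  then show "m \<in> exponents_of_weight d a (a i)"
    using i weight_single[OF i, of a 1] by (auto simp: exponents_of_weight_def exponents_def)
qed

text \<open>The constant and linear coefficients of \<open>f\<close> are each the only contribution
  to the coefficient of t^0 or t^(a i) in the image of \<open>f\<close>, which vanishes.\<close>

lemma defining_ideal_order_ge_2:
  assumes pos: "\<forall>i\<in>{1..d}. a i > 0" and nr: "nonredundant d a"
    and f: "f \<in> defining_ideal d a" and deg: "monomial_degree d m < 2"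
  shows "f m = 0"
proof (cases "m \<in> exponents d")
  case False
  then show ?thesis using f by (simp add: defining_ideal_iff mps_ring_def)
next
  case m: True
  have "subst_hom d a f = 0" using f by (simp add: defining_ideal_iff)
  then have "fps_nth (subst_hom d a f) n = 0" for n by simp
  then have sum0: "(\<Sum>m\<in>exponents_of_weight d a n. f m) = 0" for n
    by (simp add: subst_hom_def)
  show ?thesis
  proof (cases "m = 0")
    case True
    have "exponents_of_weight d a 0 = {0}"
      using weight_eq_0_iff[OF pos] by (auto simp: exponents_of_weight_def)
    then show ?thesis using sum0[of 0] True by simp
  next
    case False
    then obtain i where "i \<in> Poly_Mapping.keys m" by fastforce
    then have i: "i \<in> {1..d}" and "0 < Poly_Mapping.lookup m i"
      using m unfolding exponents_def by (blast, simp add: in_keys_iff)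
    then obtain r where r: "m = Poly_Mapping.single i 1 + r"
      using single_add_diff[of m i] by auto
    then have "monomial_degree d r = 0"
      using deg weight_single[OF i, of "\<lambda>_. 1" 1] by (simp add: weight_add)
    then have "m = Poly_Mapping.single i 1"
      using weight_eq_0_iff[of d "\<lambda>_. 1" r] m r by (simp add: exponents_add_iff)
    then show ?thesis
      using sum0[of "a i"] nonredundant_exponents_of_weight[OF pos nr i] by simp
  qed
qed

section \<open>Orders of products\<close>

text \<open>Degree is additive, so in every splitting of \<open>m\<close> at least one factor lies
  below its own bound.\<close>

lemma mps_mult_order:
  assumes "\<And>m. monomial_degree d m < k \<Longrightarrow> f m = 0" "\<And>m. monomial_degree d m < l \<Longrightarrow> g m = 0"
    and "monomial_degree d m < k + l"
  shows "(f \<otimes>\<^bsub>mps_ring d\<^esub> g) m = 0"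
proof -
  have "f p * g q = 0" if "p + q = m" for p q
  proof -
    have "monomial_degree d p < k \<or> monomial_degree d q < l"
      using assms(3) unfolding that[symmetric] weight_add by linarith
    then show ?thesis using assms(1,2) by auto
  qed
  then show ?thesis
    by (auto simp: mps_ring_def antidiag_def intro!: sum.neutral)
qed

lemma ideal_prod_order:
  assumes "\<And>f m. f \<in> I \<Longrightarrow> monomial_degree d m < k \<Longrightarrow> f m = 0"
    and "\<And>f m. f \<in> J \<Longrightarrow> monomial_degree d m < l \<Longrightarrow> f m = 0"
    and "f \<in> I \<cdot>\<^bsub>mps_ring d\<^esub> J" and "monomial_degree d m < k + l"
  shows "f m = 0"
  using assms(3)
proof (induction rule: ideal_prod.induct)
  case (prod f g)
  then show ?case using mps_mult_order[of d k f l g m] assms by blast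
next
  case (sum f g)
  then show ?case by (simp add: mps_add_apply)
qed

section \<open>Binomials in P and the Hankel determinant\<close>

text \<open>Both products are sent to the same power of t.\<close>

lemma mps_var_binomial_mem_defining_ideal:
  assumes pos: "\<forall>i\<in>{1..d}. a i > 0"
    and "i \<in> {1..d}" "j \<in> {1..d}" "k \<in> {1..d}" "l \<in> {1..d}" "a i + a j = a k + a l"
  shows "mps_var i \<otimes>\<^bsub>mps_ring d\<^esub> mps_var j \<ominus>\<^bsub>mps_ring d\<^esub> mps_var k \<otimes>\<^bsub>mps_ring d\<^esub> mps_var l
           \<in> (defining_ideal d a :: ((nat \<Rightarrow>\<^sub>0 nat) \<Rightarrow> 'a::comm_ring_1) set)"
proof -
  let ?R = "mps_ring d :: ((nat \<Rightarrow>\<^sub>0 nat) \<Rightarrow> 'a) ring"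
  interpret R: cring ?R by (rule cring_mps_ring)
  note [simp] = mps_var_closed
  let ?u = "mps_var i \<otimes>\<^bsub>?R\<^esub> mps_var j" and ?v = "mps_var k \<otimes>\<^bsub>?R\<^esub> mps_var l"
  have closed: "?u \<in> carrier ?R" "?v \<in> carrier ?R"
    using assms by simp_all
  have "subst_hom d a ?u = subst_hom d a ?v"
    using assms by (simp add: subst_hom_mult subst_hom_var power_add[symmetric])
  then have "subst_hom d a (?u \<ominus>\<^bsub>?R\<^esub> ?v) = 0"
    by (simp add: subst_hom_def mps_minus_apply[OF closed] sum_subtractf fps_eq_iff)
  then show ?thesis using closed by (simp add: defining_ideal_iff)
qed

theorem theorem2p5:
  fixes d :: nat and a :: "nat \<Rightarrow> nat"
    and R :: "((nat \<Rightarrow>\<^sub>0 nat) \<Rightarrow> 'a::field) ring"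
    and P :: "((nat \<Rightarrow>\<^sub>0 nat) \<Rightarrow> 'a) set"
  assumes "R = mps_ring d"
    and "P = defining_ideal d a"
    and "strict_mono_on {1..d} a"
    and "\<forall>i\<in>{1..d}. a i > 0"
    and "Gcd (a ` {1..d}) = 1"
    and "nonredundant d a"
    and "has_arith_subseq d a 5"
  shows "P [^]\<^bsub>ideals_set R\<^esub> (2::nat) \<noteq> symbolic_power R P 2"
proof -
  note pos = assms(4)
  interpret R: cring R unfolding assms(1) by (rule cring_mps_ring)
  interpret P: primeideal P R
    unfolding assms(1,2) by (rule primeideal_defining_ideal[OF pos])
  have P2: "P [^]\<^bsub>ideals_set R\<^esub> (2::nat) = P \<cdot>\<^bsub>R\<^esub> P"
    by (rule R.ideals_set_power2) (rule P.is_ideal)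
  interpret PP: ideal "P \<cdot>\<^bsub>R\<^esub> P" R
    by (intro R.ideal_prod_is_ideal P.is_ideal)
  obtain k \<delta> where mono: "strict_mono_on {..<5} k" and k: "k ` {..<5::nat} \<subseteq> {1..d}"
    and step: "\<And>j. Suc j < 5 \<Longrightarrow> a (k (Suc j)) = a (k j) + \<delta>"
    using assms(7) unfolding has_arith_subseq_def by blast
  have k_in: "k j \<in> {1..d}" if "j < 5" for j using k that by auto
  have k_inj: "k i = k j \<longleftrightarrow> i = j" if "i < 5" "j < 5" for i j
    using strict_mono_on_imp_inj_on[OF mono] that by (auto simp: inj_on_def)
  have ak: "a (k 1) = a (k 0) + \<delta>" "a (k 2) = a (k 0) + 2 * \<delta>"
    "a (k 3) = a (k 0) + 3 * \<delta>" "a (k 4) = a (k 0) + 4 * \<delta>"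
    using step[of 0] step[of 1] step[of 2] step[of 3] by (simp_all add: eval_nat_numeral)
  define x :: "nat \<Rightarrow> (nat \<Rightarrow>\<^sub>0 nat) \<Rightarrow> 'a" where "x j = mps_var (k j)" for j
  have x [simp]: "x j \<in> carrier R" if "j < 5" for j
    using k_in[OF that] mps_var_closed unfolding x_def assms(1) by blast
  define D where "D = x 0 \<otimes>\<^bsub>R\<^esub> x 2 \<otimes>\<^bsub>R\<^esub> x 4 \<oplus>\<^bsub>R\<^esub> x 1 \<otimes>\<^bsub>R\<^esub> x 2 \<otimes>\<^bsub>R\<^esub> x 3 \<oplus>\<^bsub>R\<^esub> x 1 \<otimes>\<^bsub>R\<^esub> x 2 \<otimes>\<^bsub>R\<^esub> x 3
    \<ominus>\<^bsub>R\<^esub> x 2 \<otimes>\<^bsub>R\<^esub> x 2 \<otimes>\<^bsub>R\<^esub> x 2 \<ominus>\<^bsub>R\<^esub> x 0 \<otimes>\<^bsub>R\<^esub> x 3 \<otimes>\<^bsub>R\<^esub> x 3 \<ominus>\<^bsub>R\<^esub> x 1 \<otimes>\<^bsub>R\<^esub> x 1 \<otimes>\<^bsub>R\<^esub> x 4"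
  have D_closed: "D \<in> carrier R" by (simp add: D_def)
  \<comment> \<open>In an arithmetic progression equal index sums give equal sums of terms, so this
    covers every minor in the condensation identity.\<close>
  have minor: "x i \<otimes>\<^bsub>R\<^esub> x j \<ominus>\<^bsub>R\<^esub> x m \<otimes>\<^bsub>R\<^esub> x n \<in> P"
    if "i < 5" "j < 5" "m < 5" "n < 5" "a (k i) + a (k j) = a (k m) + a (k n)" for i j m n
    using mps_var_binomial_mem_defining_ideal[OF pos] k_in that unfolding x_def assms(1,2) by blast
  have "x 2 \<otimes>\<^bsub>R\<^esub> D = (x 0 \<otimes>\<^bsub>R\<^esub> x 2 \<ominus>\<^bsub>R\<^esub> x 1 \<otimes>\<^bsub>R\<^esub> x 1) \<otimes>\<^bsub>R\<^esub> (x 2 \<otimes>\<^bsub>R\<^esub> x 4 \<ominus>\<^bsub>R\<^esub> x 3 \<otimes>\<^bsub>R\<^esub> x 3)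
    \<ominus>\<^bsub>R\<^esub> (x 1 \<otimes>\<^bsub>R\<^esub> x 3 \<ominus>\<^bsub>R\<^esub> x 2 \<otimes>\<^bsub>R\<^esub> x 2) \<otimes>\<^bsub>R\<^esub> (x 1 \<otimes>\<^bsub>R\<^esub> x 3 \<ominus>\<^bsub>R\<^esub> x 2 \<otimes>\<^bsub>R\<^esub> x 2)"
    unfolding D_def by (rule R.hankel_condensation) simp_all
  also have "\<dots> \<in> P \<cdot>\<^bsub>R\<^esub> P"
    \<comment> \<open>The patterns select only the outer difference, turning it into a sum with an
      additive inverse; the minors keep the form in which \<open>minor\<close> applies to
      them.\<close>
    unfolding a_minus_def[of R "(_ \<otimes>\<^bsub>R\<^esub> _)" "(_ \<ominus>\<^bsub>R\<^esub> _) \<otimes>\<^bsub>R\<^esub> _"]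
    by (intro PP.a_closed PP.a_inv_closed ideal_prod.prod minor) (simp_all add: ak[unfolded One_nat_def])
  finally have "x 2 \<otimes>\<^bsub>R\<^esub> D \<in> P [^]\<^bsub>ideals_set R\<^esub> (2::nat)"
    unfolding P2 .
  \<comment> \<open>The multiplier \<open>s\<close> in the symbolic power is \<open>x 2\<close>: its
    image is a power of t, hence nonzero.\<close>
  moreover have "x 2 \<in> carrier R - P"
    using k_in[of 2] subst_hom_var[OF pos, of "k 2", where ?'a = 'a] x[of 2]
    by (simp add: defining_ideal_iff x_def assms(2))
  ultimately have D_mem: "D \<in> symbolic_power R P 2"
    using D_closed unfolding symbolic_power_def by blast

  \<comment> \<open>\<open>?m\<close> is the exponent of the diagonal term of the determinant. Its
    coefficient is 1 in every characteristic, unlike that of \<open>x 1\<close>, \<open>x 2\<close>,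
    \<open>x 3\<close>, which is 2.\<close>
  let ?s = "\<lambda>j. Poly_Mapping.single (k j) (1::nat)"
  let ?m = "?s 0 + ?s 2 + ?s 4"
  have cubic: "x i \<otimes>\<^bsub>R\<^esub> x j \<otimes>\<^bsub>R\<^esub> x l = mps_monom (?s i + ?s j + ?s l)" for i j l
    by (simp add: x_def assms(1) mps_var_eq_monom mps_monom_mult)
  have lookup_s: "Poly_Mapping.lookup (?s i) (k j) = (if i = j then 1 else 0)" if "i < 5" "j < 5" for i j
    using k_inj[OF that] by (simp add: lookup_single when_def)
  have lookup_neq: "p \<noteq> q" if "Poly_Mapping.lookup p (k j) \<noteq> Poly_Mapping.lookup q (k j)"
    for p q :: "nat \<Rightarrow>\<^sub>0 nat" and j
    using that by auto
  have ne: "?m \<noteq> ?s 1 + ?s 2 + ?s 3" "?m \<noteq> ?s 2 + ?s 2 + ?s 2" "?m \<noteq> ?s 0 + ?s 3 + ?s 3"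
    "?m \<noteq> ?s 1 + ?s 1 + ?s 4"
    \<comment> \<open>The exponent of \<open>x 0\<close> separates \<open>?m\<close> from all the
      other monomials except the one containing \<open>x 0\<close> and the square of
      \<open>x 3\<close>; there the exponent of \<open>x 2\<close> does.\<close>
    using lookup_neq[of ?m 0 "?s 1 + ?s 2 + ?s 3"] lookup_neq[of ?m 0 "?s 2 + ?s 2 + ?s 2"]
      lookup_neq[of ?m 2 "?s 0 + ?s 3 + ?s 3"] lookup_neq[of ?m 0 "?s 1 + ?s 1 + ?s 4"]
    by (simp_all add: lookup_add lookup_s del: One_nat_def)
  have minus: "(f \<ominus>\<^bsub>R\<^esub> g) m = f m - g m" if "f \<in> carrier R" "g \<in> carrier R" for f g m
    using that mps_minus_apply unfolding assms(1) by blast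
  have add: "(f \<oplus>\<^bsub>R\<^esub> g) m = f m + g m" for f g m
    by (simp add: assms(1) mps_add_apply)
  have "D ?m = (x 0 \<otimes>\<^bsub>R\<^esub> x 2 \<otimes>\<^bsub>R\<^esub> x 4) ?m + (x 1 \<otimes>\<^bsub>R\<^esub> x 2 \<otimes>\<^bsub>R\<^esub> x 3) ?m + (x 1 \<otimes>\<^bsub>R\<^esub> x 2 \<otimes>\<^bsub>R\<^esub> x 3) ?m
    - (x 2 \<otimes>\<^bsub>R\<^esub> x 2 \<otimes>\<^bsub>R\<^esub> x 2) ?m - (x 0 \<otimes>\<^bsub>R\<^esub> x 3 \<otimes>\<^bsub>R\<^esub> x 3) ?m - (x 1 \<otimes>\<^bsub>R\<^esub> x 1 \<otimes>\<^bsub>R\<^esub> x 4) ?m"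
    by (simp add: D_def minus add)
  also have "\<dots> = 1"
    unfolding cubic using ne by (simp add: mps_monom_def)
  finally have "D ?m \<noteq> 0" by simp
  \<comment> \<open>Degree 3 lies below 4, the least order possible in P^2, so this nonzero
    coefficient excludes \<open>D\<close>.\<close>
  moreover have "monomial_degree d ?m < 2 + 2"
    using weight_single[OF k_in, of _ "\<lambda>_. 1" 1] by (simp add: weight_add)
  ultimately have "D \<notin> P \<cdot>\<^bsub>R\<^esub> P"
    using ideal_prod_order[of P d 2 P 2 D ?m] defining_ideal_order_ge_2[OF pos assms(6)]
    unfolding assms(1,2) by blast
  then have "D \<notin> P [^]\<^bsub>ideals_set R\<^esub> (2::nat)"
    unfolding P2 .
  then show ?thesis using D_mem by blast
qed

end
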